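(* Let $f:\omega\to\omega$ be a bijection and let $f^*$ be its pullback. Let $S\subseteq\omega$ be an infinite computable set, and suppose that the map $f^*_S:\mathcal D_S\to\mathcal D_S$, $f^*_S([g]_S)=[f^*(g)]_S$, is (well defined and) an automorphism of $\mathcal D_S$. Then $f$ is computable.
   Context: The pullback of $f:\omega\to\omega$ is $f^*:\omega^\omega\to\omega^\omega$, $f^*(A)(n)=A(f(n))$; it maps $S^\omega$ into $S^\omega$. For $S\subseteq\omega$, $\mathcal D_S=S^\omega/\equiv_{\mathrm T}$, with elements $[g]_S=\{h\in S^\omega: h\equiv_{\mathrm T} g\}$, ordered by Turing reducibility. An automorphism of $\mathcal D_S$ is a bijection $\pi$ with $\mathbf x\le\mathbf y$ iff $\pi(\mathbf x)\le\pi(\mathbf y)$. *)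

theory Defs
  imports Main
begin

text \<open>
  Partial functions on \<open>\<omega>\<close> are modelled as \<open>nat list \<rightharpoonup> nat\<close>, where \<open>None\<close> means divergence.
  In \<open>partial_recursive_in G n F\<close> the number \<open>n\<close> is the arity: only the values of \<open>F\<close> on
  lists of length \<open>n\<close> are meaningful.
\<close>

definition compose :: "(nat list \<rightharpoonup> nat) \<Rightarrow> (nat list \<rightharpoonup> nat) list \<Rightarrow> (nat list \<rightharpoonup> nat)" where
  "compose F Hs = (\<lambda>xs. Option.bind (those (map (\<lambda>H. H xs) Hs)) F)"

definition primitive_recursion ::
  "(nat list \<rightharpoonup> nat) \<Rightarrow> (nat list \<rightharpoonup> nat) \<Rightarrow> (nat list \<rightharpoonup> nat)" where
  "primitive_recursion F H =
    (\<lambda>xs. rec_nat (F (tl xs)) (\<lambda>k r. Option.bind r (\<lambda>y. H (k # y # tl xs))) (hd xs))"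

definition minimization :: "(nat list \<rightharpoonup> nat) \<Rightarrow> (nat list \<rightharpoonup> nat)" where
  "minimization F =
    (\<lambda>xs. let P = (\<lambda>m. F (m # xs) = Some 0 \<and> (\<forall>k<m. \<exists>y>0. F (k # xs) = Some y))
          in if \<exists>m. P m then Some (THE m. P m) else None)"

inductive partial_recursive_in ::
  "(nat \<Rightarrow> nat) set \<Rightarrow> nat \<Rightarrow> (nat list \<rightharpoonup> nat) \<Rightarrow> bool" for G where
  zero: "partial_recursive_in G n (\<lambda>xs. Some 0)"
| succ: "partial_recursive_in G 1 (\<lambda>xs. Some (Suc (hd xs)))"
| proj: "i < n \<Longrightarrow> partial_recursive_in G n (\<lambda>xs. Some (xs ! i))"
| query: "g \<in> G \<Longrightarrow> partial_recursive_in G 1 (\<lambda>xs. Some (g (hd xs)))"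
| comp: "partial_recursive_in G (length Hs) F \<Longrightarrow>
    (\<And>H. H \<in> set Hs \<Longrightarrow> partial_recursive_in G n H) \<Longrightarrow>
    partial_recursive_in G n (compose F Hs)"
| prim_rec: "partial_recursive_in G n F \<Longrightarrow> partial_recursive_in G (Suc (Suc n)) H \<Longrightarrow>
    partial_recursive_in G (Suc n) (primitive_recursion F H)"
| mu: "partial_recursive_in G (Suc n) F \<Longrightarrow> partial_recursive_in G n (minimization F)"

definition recursive_in :: "(nat \<Rightarrow> nat) set \<Rightarrow> (nat \<Rightarrow> nat) \<Rightarrow> bool" where
  "recursive_in G h \<longleftrightarrow> (\<exists>F. partial_recursive_in G 1 F \<and> (\<forall>x. F [x] = Some (h x)))"

definition computable :: "(nat \<Rightarrow> nat) \<Rightarrow> bool" where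
  "computable h \<longleftrightarrow> recursive_in {} h"

definition computable_set :: "nat set \<Rightarrow> bool" where
  "computable_set S \<longleftrightarrow> computable (\<lambda>n. if n \<in> S then 1 else 0)"

definition turing_le :: "(nat \<Rightarrow> nat) \<Rightarrow> (nat \<Rightarrow> nat) \<Rightarrow> bool" (infix "\<le>\<^sub>T" 50) where
  "h \<le>\<^sub>T g \<longleftrightarrow> recursive_in {g} h"

definition turing_equiv :: "(nat \<Rightarrow> nat) \<Rightarrow> (nat \<Rightarrow> nat) \<Rightarrow> bool" (infix "\<equiv>\<^sub>T" 50) where
  "h \<equiv>\<^sub>T g \<longleftrightarrow> h \<le>\<^sub>T g \<and> g \<le>\<^sub>T h"

definition pullback :: "(nat \<Rightarrow> nat) \<Rightarrow> (nat \<Rightarrow> nat) \<Rightarrow> (nat \<Rightarrow> nat)" where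
  "pullback f A = (\<lambda>n. A (f n))"

definition seqs :: "nat set \<Rightarrow> (nat \<Rightarrow> nat) set" where
  "seqs S = {g. \<forall>n. g n \<in> S}"

definition degree :: "nat set \<Rightarrow> (nat \<Rightarrow> nat) \<Rightarrow> (nat \<Rightarrow> nat) set" where
  "degree S g = {h \<in> seqs S. h \<equiv>\<^sub>T g}"

definition degrees :: "nat set \<Rightarrow> (nat \<Rightarrow> nat) set set" where
  "degrees S = degree S ` seqs S"

definition degree_le :: "(nat \<Rightarrow> nat) set \<Rightarrow> (nat \<Rightarrow> nat) set \<Rightarrow> bool" where
  "degree_le X Y \<longleftrightarrow> (\<exists>g\<in>X. \<exists>h\<in>Y. g \<le>\<^sub>T h)"

definition degree_automorphism ::
  "nat set \<Rightarrow> ((nat \<Rightarrow> nat) set \<Rightarrow> (nat \<Rightarrow> nat) set) \<Rightarrow> bool" where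
  "degree_automorphism S \<pi> \<longleftrightarrow>
    bij_betw \<pi> (degrees S) (degrees S) \<and>
    (\<forall>X\<in>degrees S. \<forall>Y\<in>degrees S. degree_le X Y \<longleftrightarrow> degree_le (\<pi> X) (\<pi> Y))"

lemma turing_le_refl: "g \<le>\<^sub>T g"
proof -
  have "partial_recursive_in {g} 1 (\<lambda>xs. Some (g (hd xs)))"
    by (rule partial_recursive_in.query) simp
  then show ?thesis
    unfolding turing_le_def recursive_in_def by (intro exI conjI) auto
qed

lemma partial_recursive_in_trans:
  assumes "partial_recursive_in G n F" "\<And>g. g \<in> G \<Longrightarrow> recursive_in K g"
  shows "\<exists>F'. partial_recursive_in K n F' \<and> (\<forall>xs. length xs = n \<longrightarrow> F' xs = F xs)"
  using assms(1)
proof induction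
  case (zero n)
  then show ?case using partial_recursive_in.zero by blast
next
  case succ
  then show ?case using partial_recursive_in.succ by blast
next
  case (proj i n)
  then show ?case using partial_recursive_in.proj by blast
next
  case (query g)
  then obtain F where "partial_recursive_in K 1 F" "\<forall>x. F [x] = Some (g x)"
    using assms(2) unfolding recursive_in_def by blast
  then show ?case by (intro exI[of _ F]) (auto simp: length_Suc_conv)
next
  case (comp Hs F n)
  obtain F' where F': "partial_recursive_in K (length Hs) F'"
      "\<And>xs. length xs = length Hs \<Longrightarrow> F' xs = F xs"
    using comp.IH(1) by blast
  have "\<forall>H\<in>set Hs. \<exists>H'. partial_recursive_in K n H' \<and> (\<forall>xs. length xs = n \<longrightarrow> H' xs = H xs)"
    using comp.IH(2) by blast
  then obtain r where r: "\<And>H. H \<in> set Hs \<Longrightarrow> partial_recursive_in K n (r H)"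
      "\<And>H xs. H \<in> set Hs \<Longrightarrow> length xs = n \<Longrightarrow> r H xs = H xs"
    by metis
  have len: "those ys = Some zs \<Longrightarrow> length zs = length ys" for ys :: "nat option list" and zs
    by (induction ys arbitrary: zs) (auto split: option.splits)
  have "partial_recursive_in K n (compose F' (map r Hs))"
    using F' r by (intro partial_recursive_in.comp) auto
  moreover have "compose F' (map r Hs) xs = compose F Hs xs" if "length xs = n" for xs
  proof -
    have eq: "map (\<lambda>H. H xs) (map r Hs) = map (\<lambda>H. H xs) Hs"
      using r(2) that by simp
    show ?thesis
      unfolding compose_def eq
      by (cases "those (map (\<lambda>H. H xs) Hs)") (auto dest!: len simp: F'(2))
  qed
  ultimately show ?case by blast
next
  case (prim_rec n F H)
  then obtain F' H' where *: "partial_recursive_in K n F'" "partial_recursive_in K (Suc (Suc n)) H'"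
      "\<And>xs. length xs = n \<Longrightarrow> F' xs = F xs" "\<And>xs. length xs = Suc (Suc n) \<Longrightarrow> H' xs = H xs"
    by blast
  have "primitive_recursion F' H' xs = primitive_recursion F H xs" if "length xs = Suc n" for xs
    unfolding primitive_recursion_def using that * by simp
  with * show ?case using partial_recursive_in.prim_rec by blast
next
  case (mu n F)
  then obtain F' where *: "partial_recursive_in K (Suc n) F'"
      "\<And>xs. length xs = Suc n \<Longrightarrow> F' xs = F xs"
    by blast
  have "minimization F' xs = minimization F xs" if "length xs = n" for xs
    unfolding minimization_def using that * by simp
  with * show ?case using partial_recursive_in.mu by blast
qed

lemma turing_le_trans:
  assumes "f \<le>\<^sub>T g" "g \<le>\<^sub>T h"
  shows "f \<le>\<^sub>T h"
proof -
  obtain F where F: "partial_recursive_in {g} 1 F" "\<forall>x. F [x] = Some (f x)"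
    using assms(1) unfolding turing_le_def recursive_in_def by blast
  obtain F' where "partial_recursive_in {h} 1 F'" "\<forall>xs. length xs = 1 \<longrightarrow> F' xs = F xs"
    using partial_recursive_in_trans[OF F(1), of "{h}"] assms(2) unfolding turing_le_def by auto
  with F(2) show ?thesis unfolding turing_le_def recursive_in_def by force
qed

end

theory Submission
  imports Defs "HOL-Library.Infinite_Set"
begin

text \<open>
  Let \<open>g\<close> enumerate \<open>S\<close> in increasing order and let \<open>c\<close> be a constant sequence with value in \<open>S\<close>.
  Both are computable, so they have the same degree, and since \<open>\<pi>\<close> is well defined their pullbacks
  have the same degree too. The pullback of \<open>c\<close> is \<open>c\<close> itself, hence \<open>g \<circ> f\<close> is computable, and
  \<open>f n\<close> is found by searching for the least \<open>m\<close> with \<open>g (f n) \<le> g m\<close>.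
\<close>

text \<open>Strips the option type, so that closure rules speak about ordinary terms. Agreement is
  asked only on lists of length \<open>n\<close>, because other lists carry no meaning at arity
  \<open>n\<close>.\<close>

definition total_recursive_in :: "(nat \<Rightarrow> nat) set \<Rightarrow> nat \<Rightarrow> (nat list \<Rightarrow> nat) \<Rightarrow> bool" where
  "total_recursive_in G n h \<longleftrightarrow>
    (\<exists>F. partial_recursive_in G n F \<and> (\<forall>xs. length xs = n \<longrightarrow> F xs = Some (h xs)))"

lemma recursive_in_iff_total: "recursive_in G h \<longleftrightarrow> total_recursive_in G 1 (\<lambda>xs. h (xs ! 0))"
  unfolding recursive_in_def total_recursive_in_def by (auto simp: length_Suc_conv)

lemma total_recursive_in_cong:
  assumes "total_recursive_in G n h" "\<And>xs. length xs = n \<Longrightarrow> h xs = h' xs"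
  shows "total_recursive_in G n h'"
  using assms unfolding total_recursive_in_def by metis

lemma total_recursive_in_nth:
  assumes "i < n"
  shows "total_recursive_in G n (\<lambda>xs. xs ! i)"
  unfolding total_recursive_in_def using partial_recursive_in.proj[OF assms] by blast

lemma total_recursive_in_comp:
  assumes "total_recursive_in G (length hs) a" "\<And>h. h \<in> set hs \<Longrightarrow> total_recursive_in G n h"
  shows "total_recursive_in G n (\<lambda>xs. a (map (\<lambda>h. h xs) hs))"
proof -
  obtain F where F: "partial_recursive_in G (length hs) F"
      "\<And>xs. length xs = length hs \<Longrightarrow> F xs = Some (a xs)"
    using assms(1) unfolding total_recursive_in_def by blast
  obtain r where r: "\<And>h. h \<in> set hs \<Longrightarrow> partial_recursive_in G n (r h)"
      "\<And>h xs. h \<in> set hs \<Longrightarrow> length xs = n \<Longrightarrow> r h xs = Some (h xs)"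
    using assms(2) unfolding total_recursive_in_def by metis
  have those_Some: "those (map Some ys) = Some ys" for ys :: "nat list"
    by (induction ys) auto
  have "compose F (map r hs) xs = Some (a (map (\<lambda>h. h xs) hs))" if "length xs = n" for xs
  proof -
    have "map (\<lambda>H. H xs) (map r hs) = map Some (map (\<lambda>h. h xs) hs)"
      using r(2) that by simp
    then show ?thesis unfolding compose_def by (simp only: those_Some) (simp add: F(2))
  qed
  moreover have "partial_recursive_in G n (compose F (map r hs))"
    using F(1) r(1) by (intro partial_recursive_in.comp) auto
  ultimately show ?thesis unfolding total_recursive_in_def by blast
qed

text \<open>Composition with the list of inner functions fixed as \<open>[h]\<close>, so that the
  outer function can be an ordinary function on numbers.\<close>

lemma total_recursive_in_comp1:
  assumes "recursive_in G a" "total_recursive_in G n h"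
  shows "total_recursive_in G n (\<lambda>xs. a (h xs))"
  using total_recursive_in_comp[of G "[h]" "\<lambda>xs. a (xs ! 0)" n] assms
  by (simp add: recursive_in_iff_total)

lemma total_recursive_in_comp2:
  assumes "total_recursive_in G 2 (\<lambda>xs. b (xs ! 0) (xs ! 1))"
    and "total_recursive_in G n h" "total_recursive_in G n k"
  shows "total_recursive_in G n (\<lambda>xs. b (h xs) (k xs))"
  using total_recursive_in_comp[of G "[h, k]" "\<lambda>xs. b (xs ! 0) (xs ! 1)" n] assms
  by (auto simp: numeral_2_eq_2)

lemma recursive_in_Suc: "recursive_in G Suc"
  unfolding recursive_in_def using partial_recursive_in.succ[of G] by (intro exI conjI) auto

lemmas total_recursive_in_Suc = total_recursive_in_comp1[OF recursive_in_Suc]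

lemma total_recursive_in_const: "total_recursive_in G n (\<lambda>xs. c)"
proof (induction c)
  case 0
  show ?case unfolding total_recursive_in_def using partial_recursive_in.zero by blast
next
  case (Suc c)
  then show ?case by (rule total_recursive_in_Suc)
qed

lemma total_recursive_in_prim_rec:
  assumes "total_recursive_in G n a" "total_recursive_in G (Suc (Suc n)) b"
  shows "total_recursive_in G (Suc n)
    (\<lambda>xs. rec_nat (a (tl xs)) (\<lambda>k r. b (k # r # tl xs)) (hd xs))"
proof -
  obtain F where F: "partial_recursive_in G n F" "\<And>xs. length xs = n \<Longrightarrow> F xs = Some (a xs)"
    using assms(1) unfolding total_recursive_in_def by blast
  obtain H where H: "partial_recursive_in G (Suc (Suc n)) H"
      "\<And>xs. length xs = Suc (Suc n) \<Longrightarrow> H xs = Some (b xs)"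
    using assms(2) unfolding total_recursive_in_def by blast
  \<comment> \<open>The recursion argument \<open>hd xs\<close> is generalised to an arbitrary
    \<open>m\<close>, so that induction on it leaves the parameters \<open>tl xs\<close>
    fixed.\<close>
  have "rec_nat (F (tl xs)) (\<lambda>k r. Option.bind r (\<lambda>y. H (k # y # tl xs))) m =
      Some (rec_nat (a (tl xs)) (\<lambda>k r. b (k # r # tl xs)) m)" if "length xs = Suc n" for xs m
    using that by (induction m) (simp_all add: F(2) H(2))
  then show ?thesis
    using partial_recursive_in.prim_rec[OF F(1) H(1)]
    unfolding total_recursive_in_def primitive_recursion_def by blast
qed

text \<open>For a total function, the demand that all earlier values be defined and positive only
  says that they are nonzero. The unique \<open>m\<close> found by minimization is then the least
  zero, and the second assumption makes the search halt.\<close>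

lemma total_recursive_in_Least:
  assumes "total_recursive_in G (Suc n) a" "\<And>xs. length xs = n \<Longrightarrow> \<exists>m. a (m # xs) = 0"
  shows "total_recursive_in G n (\<lambda>xs. LEAST m. a (m # xs) = 0)"
proof -
  obtain F where F: "partial_recursive_in G (Suc n) F"
      "\<And>xs. length xs = Suc n \<Longrightarrow> F xs = Some (a xs)"
    using assms(1) unfolding total_recursive_in_def by blast
  have "minimization F xs = Some (LEAST m. a (m # xs) = 0)" if len: "length xs = n" for xs
  proof -
    let ?P = "\<lambda>m. F (m # xs) = Some 0 \<and> (\<forall>k<m. \<exists>y>0. F (k # xs) = Some y)"
    have P: "?P m \<longleftrightarrow> a (m # xs) = 0 \<and> (\<forall>k<m. a (k # xs) \<noteq> 0)" for m
      using len by (simp add: F(2))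
    let ?m = "LEAST m. a (m # xs) = 0"
    have m: "?P ?m"
      unfolding P using LeastI_ex[OF assms(2)[OF len]] not_less_Least by blast
    moreover have "m' = ?m" if "?P m'" for m'
      using that m unfolding P by (metis nat_neq_iff)
    ultimately have "(THE m. ?P m) = ?m" by (rule the_equality)
    with m show ?thesis unfolding minimization_def Let_def by auto
  qed
  then show ?thesis
    using partial_recursive_in.mu[OF F(1)] unfolding total_recursive_in_def by blast
qed

text \<open>Primitive recursion without parameters: the initial value is a constant of arity 0, and
  the step ignores the counter at position 0 and uses the previous value at position 1.\<close>

lemma recursive_in_rec_nat:
  assumes "recursive_in G b"
  shows "recursive_in G (rec_nat c (\<lambda>k. b))"
proof -
  have "total_recursive_in G (Suc (Suc 0)) (\<lambda>xs. b (xs ! 1))"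
    using assms by (intro total_recursive_in_comp1[of _ b] total_recursive_in_nth) auto
  from total_recursive_in_prim_rec[OF total_recursive_in_const this, of c]
  show ?thesis
    unfolding recursive_in_iff_total One_nat_def
    by (rule total_recursive_in_cong) (auto simp: length_Suc_conv)
qed

text \<open>The recursion step returns the counter instead of the previous value, and the value at 0
  is 0.\<close>

lemma recursive_in_pred: "recursive_in G (\<lambda>x. x - 1)"
proof -
  have "total_recursive_in G (Suc (Suc 0)) (\<lambda>xs. xs ! 0)"
    by (intro total_recursive_in_nth) auto
  from total_recursive_in_prim_rec[OF total_recursive_in_const this, of 0]
  have "total_recursive_in G 1 (\<lambda>xs. rec_nat 0 (\<lambda>k r. k) (hd xs))"
    by simp
  moreover have "rec_nat 0 (\<lambda>k r. k) x = x - 1" for x :: nat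
    by (cases x) auto
  ultimately show ?thesis
    unfolding recursive_in_iff_total
    by (elim total_recursive_in_cong) (auto simp: length_Suc_conv)
qed

text \<open>Common source of addition and truncated subtraction, which iterate successor and
  predecessor.\<close>

lemma total_recursive_in_iterate:
  assumes "recursive_in G b" "total_recursive_in G n h" "total_recursive_in G n k"
  shows "total_recursive_in G n (\<lambda>xs. (b ^^ h xs) (k xs))"
proof (rule total_recursive_in_comp2[OF _ assms(2,3)])
  have "total_recursive_in G (Suc 0) (\<lambda>xs. xs ! 0)"
    by (intro total_recursive_in_nth) auto
  moreover have "total_recursive_in G (Suc (Suc (Suc 0))) (\<lambda>xs. b (xs ! 1))"
    using assms(1) by (intro total_recursive_in_comp1[of _ b] total_recursive_in_nth) auto
  ultimately have "total_recursive_in G 2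
      (\<lambda>xs. rec_nat (tl xs ! 0) (\<lambda>k r. b ((k # r # tl xs) ! 1)) (hd xs))"
    unfolding numeral_2_eq_2 by (rule total_recursive_in_prim_rec)
  moreover have "rec_nat y (\<lambda>k. b) x = (b ^^ x) y" for x y
    by (induction x) auto
  ultimately show "total_recursive_in G 2 (\<lambda>xs. (b ^^ (xs ! 0)) (xs ! 1))"
    by (elim total_recursive_in_cong) (auto simp: length_Suc_conv numeral_2_eq_2)
qed

lemma total_recursive_in_add:
  assumes "total_recursive_in G n h" "total_recursive_in G n k"
  shows "total_recursive_in G n (\<lambda>xs. h xs + k xs)"
proof -
  have "(Suc ^^ x) y = x + y" for x y by (induction x) auto
  then show ?thesis using total_recursive_in_iterate[OF recursive_in_Suc assms] by simp
qed

lemma total_recursive_in_diff: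
  assumes "total_recursive_in G n h" "total_recursive_in G n k"
  shows "total_recursive_in G n (\<lambda>xs. h xs - k xs)"
proof -
  have "((\<lambda>x. x - 1) ^^ y) x = x - y" for x y :: nat by (induction y) auto
  \<comment> \<open>The arguments are swapped because the subtrahend counts the iterations.\<close>
  then show ?thesis using total_recursive_in_iterate[OF recursive_in_pred assms(2,1)] by simp
qed

text \<open>Transitivity for arbitrary oracle sets, so that either side may be empty; this links
  \<open>computable\<close> with Turing reducibility.\<close>

lemma recursive_in_trans:
  assumes "recursive_in G h" "\<And>g. g \<in> G \<Longrightarrow> recursive_in K g"
  shows "recursive_in K h"
proof -
  obtain F where F: "partial_recursive_in G 1 F" "\<forall>x. F [x] = Some (h x)"
    using assms(1) unfolding recursive_in_def by blast
  then obtain F' where "partial_recursive_in K 1 F'" "\<forall>xs. length xs = 1 \<longrightarrow> F' xs = F xs"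
    using partial_recursive_in_trans[OF F(1) assms(2)] by blast
  with F(2) show ?thesis unfolding recursive_in_def by force
qed

lemma turing_le_computable: "computable h \<Longrightarrow> h \<le>\<^sub>T g"
  unfolding computable_def turing_le_def by (rule recursive_in_trans) auto

lemma computable_if_turing_le: "h \<le>\<^sub>T g \<Longrightarrow> computable g \<Longrightarrow> computable h"
  unfolding computable_def turing_le_def by (rule recursive_in_trans) auto

text \<open>Each element after the first is the least element of \<open>S\<close> above its
  predecessor. Infinity of \<open>S\<close> makes the search for it halt.\<close>

lemma computable_enumerate:
  assumes "infinite S" "computable_set S"
  shows "computable (enumerate S)"
proof -
  let ?\<chi> = "\<lambda>n. if n \<in> S then 1 else 0 :: nat"
  define next_elem where "next_elem y = (LEAST s. s \<in> S \<and> y < s)" for y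
  \<comment> \<open>A conjunction in arithmetic form: a sum of naturals vanishes iff both summands
    do. The first tests membership in \<open>S\<close>; the successor in the second makes the
    inequality strict.\<close>
  let ?test = "\<lambda>xs. (1 - ?\<chi> (xs ! 0)) + (Suc (xs ! 1) - xs ! 0)"
  have test: "?test [m, y] = 0 \<longleftrightarrow> m \<in> S \<and> y < m" for m y
    by auto
  have "recursive_in {} ?\<chi>"
    using assms(2) unfolding computable_set_def computable_def .
  then have "total_recursive_in {} (Suc 1) ?test"
    by (intro total_recursive_in_add total_recursive_in_diff total_recursive_in_const
        total_recursive_in_Suc total_recursive_in_comp1[of _ ?\<chi>] total_recursive_in_nth) auto
  moreover have "\<exists>m. ?test (m # xs) = 0" if "length xs = 1" for xs
  proof -
    obtain y where "xs = [y]" using \<open>length xs = 1\<close> by (auto simp: length_Suc_conv)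
    moreover obtain m where "m \<in> S" "y < m"
      using assms(1) infinite_nat_iff_unbounded by blast
    ultimately show ?thesis using test by blast
  qed
  ultimately have "total_recursive_in {} 1 (\<lambda>xs. LEAST m. ?test (m # xs) = 0)"
    by (rule total_recursive_in_Least)
  then have "recursive_in {} next_elem"
    unfolding recursive_in_iff_total
  proof (rule total_recursive_in_cong)
    fix xs :: "nat list" assume "length xs = 1"
    then obtain y where "xs = [y]" by (auto simp: length_Suc_conv)
    then show "(LEAST m. ?test (m # xs) = 0) = next_elem (xs ! 0)"
      unfolding next_elem_def using test by simp
  qed
  then have "recursive_in {} (rec_nat (enumerate S 0) (\<lambda>k. next_elem))"
    by (rule recursive_in_rec_nat)
  moreover have "rec_nat (enumerate S 0) (\<lambda>k. next_elem) = enumerate S"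
  proof
    fix n
    show "rec_nat (enumerate S 0) (\<lambda>k. next_elem) n = enumerate S n"
      by (induction n) (simp_all add: next_elem_def enumerate_Suc''[OF assms(1)])
  qed
  ultimately show ?thesis unfolding computable_def by simp
qed

lemma computable_if_strict_mono_comp:
  assumes "strict_mono g" "computable g" "computable (\<lambda>n. g (f n))"
  shows "computable f"
proof -
  let ?p = "\<lambda>n. g (f n)"
  \<comment> \<open>Truncated subtraction vanishes exactly when \<open>?p n \<le> g m\<close>, with
    the candidate \<open>m\<close> at position 0 and the input \<open>n\<close> at position
    1.\<close>
  let ?test = "\<lambda>xs. ?p (xs ! 1) - g (xs ! 0)"
  have "total_recursive_in {} (Suc 1) ?test"
    using assms(2,3) unfolding computable_def
    by (intro total_recursive_in_diff total_recursive_in_comp1[of _ g]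
        total_recursive_in_comp1[of _ ?p] total_recursive_in_nth) auto
  moreover have "\<exists>m. ?test (m # xs) = 0" for xs
    by (rule exI[of _ "f (xs ! 0)"]) simp
  ultimately have "total_recursive_in {} 1 (\<lambda>xs. LEAST m. ?test (m # xs) = 0)"
    by (rule total_recursive_in_Least)
  \<comment> \<open>Strict monotonicity reduces \<open>g (f n) \<le> g m\<close> to
    \<open>f n \<le> m\<close>, whose least solution is \<open>f n\<close>.\<close>
  moreover have "(LEAST m. ?test (m # xs) = 0) = f (xs ! 0)" for xs
    using strict_mono_less_eq[OF assms(1)] by (intro Least_equality) auto
  ultimately show ?thesis unfolding computable_def recursive_in_iff_total by simp
qed

theorem theorem2p4:
  fixes f :: "nat \<Rightarrow> nat" and S :: "nat set"
    and \<pi> :: "(nat \<Rightarrow> nat) set \<Rightarrow> (nat \<Rightarrow> nat) set"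
  assumes "bij f"
    and "infinite S"
    and "computable_set S"
    and "\<And>g. g \<in> seqs S \<Longrightarrow> \<pi> (degree S g) = degree S (pullback f g)"
    and "degree_automorphism S \<pi>"
  shows "computable f"
proof -
  let ?g = "enumerate S"
  obtain s where "s \<in> S" using infinite_imp_nonempty[OF assms(2)] by blast
  define c where "c = (\<lambda>n::nat. s)"
  have c: "c \<in> seqs S" "computable c" "pullback f c = c"
    using \<open>s \<in> S\<close> total_recursive_in_const
    by (auto simp: c_def seqs_def computable_def recursive_in_iff_total pullback_def)
  have g: "?g \<in> seqs S" "computable ?g"
    using assms(2,3) by (auto simp: seqs_def enumerate_in_set computable_enumerate)
  have "?g \<equiv>\<^sub>T c"
    using c g by (simp add: turing_equiv_def turing_le_computable)
  then have "degree S ?g = degree S c"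
    unfolding degree_def turing_equiv_def using turing_le_trans by blast
  \<comment> \<open>Both sides are values of \<open>\<pi>\<close> at the same degree.\<close>
  then have "degree S (pullback f ?g) = degree S c"
    using assms(4)[OF g(1)] assms(4)[OF c(1)] c(3) by simp
  \<comment> \<open>A degree contains its representative, which turns the equality of degrees into a
    reduction to \<open>c\<close>.\<close>
  moreover have "pullback f ?g \<in> degree S (pullback f ?g)"
    using g(1) by (simp add: degree_def seqs_def pullback_def turing_equiv_def turing_le_refl)
  ultimately have "pullback f ?g \<le>\<^sub>T c"
    by (simp add: degree_def turing_equiv_def)
  then have "computable (\<lambda>n. ?g (f n))"
    using c(2) computable_if_turing_le by (simp add: pullback_def)
  then show ?thesis
    by (rule computable_if_strict_mono_comp[OF strict_mono_enumerate[OF assms(2)] g(2)])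
qed

end
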